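(* Let $\mathbf G=(V,E)$ be a finite simple undirected graph, and let $\overline{\mathbf G}=(V,\overline E)$ be its complement. Let $z$ and $\mathbf z_{\overline E}=(z_{uv})_{uv\in\overline E}$ be independent commuting indeterminates, and define $$\Psi_{\overline{\mathbf G}}(z,\mathbf z_{\overline E})=\prod_{v\in V}\bigl(1+z\,Z_{\overline E(v)}\bigr)\prod_{uv\in\overline E}(1+z_{uv}),$$ where $Z_{\overline E(v)}$ is the product of the $z_e$ over all edges $e\in\overline E$ incident to $v$. Then the graph polynomial $\pi_\gamma(z)$ of the number of cliques of $\mathbf G$ is $$\pi_\gamma(z)=\Bigl[\textstyle\prod_{uv\in\overline E}z_{uv}\Bigr]\,\Psi_{\overline{\mathbf G}}(z,\mathbf z_{\overline E}).$$
   Context: A clique of $\mathbf G$ is a subset of $V$ such that every pair of distinct vertices in the subset is adjacent (so the empty set and singletons are cliques). $C_k$ is the number of cliques of size (cardinality) $k\ge0$, and $\pi_\gamma(z)=\sum_{k\ge0}C_kz^k$. The complement $\overline{\mathbf G}$ is the simple graph on $V$ in which two distinct vertices are adjacent if and only if they are not adjacent in $\mathbf G$; $\overline E$ is its edge set. The bracket $[\prod_{uv\in\overline E}z_{uv}]F$ denotes the coefficient of the monomial $\prod_{uv\in\overline E}z_{uv}$ when $F$ is regarded as a polynomial in the edge indeterminates with coefficients that are polynomials in $z$. An empty product equals $1$. *)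

theory Defs
  imports
    "HOL-Library.Ramsey"
    "HOL-Library.Poly_Mapping"
    "HOL-Computational_Algebra.Polynomial"
begin

definition finite_simple_graph :: "'a set \<Rightarrow> 'a set set \<Rightarrow> bool" where
  "finite_simple_graph V E \<longleftrightarrow> finite V \<and> E \<subseteq> [V]\<^bsup>2\<^esup>"

definition complement_edges :: "'a set \<Rightarrow> 'a set set \<Rightarrow> 'a set set" where
  "complement_edges V E = [V]\<^bsup>2\<^esup> - E"

definition clique_count :: "'a set \<Rightarrow> 'a set set \<Rightarrow> nat \<Rightarrow> nat" where
  "clique_count V E k = card {K. K \<subseteq> V \<and> clique K E \<and> card K = k}"

text \<open>For finite \<open>V\<close> no clique has more than \<open>card V\<close> vertices, so the generating polynomial is a finite sum.\<close>

definition clique_poly :: "'a set \<Rightarrow> 'a set set \<Rightarrow> 'r::comm_ring_1 poly" where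
  "clique_poly V E = (\<Sum>k\<le>card V. monom (of_nat (clique_count V E k)) k)"

text \<open>
  Polynomials in indeterminates indexed by edges, with coefficients that are polynomials
  in \<open>z\<close>, are finitely supported maps from exponent vectors to coefficients, that is,
  the monoid algebra of the commutative monoid \<^typ>\<open>'a set \<Rightarrow>\<^sub>0 nat\<close> over \<^typ>\<open>'r poly\<close>.
\<close>

type_synonym ('a, 'r) edge_poly = "('a set \<Rightarrow>\<^sub>0 nat) \<Rightarrow>\<^sub>0 'r poly"

definition vertex_var :: "('a, 'r::comm_ring_1) edge_poly" where
  "vertex_var = Poly_Mapping.single 0 (monom 1 1)"

definition edge_var :: "'a set \<Rightarrow> ('a, 'r::comm_ring_1) edge_poly" where
  "edge_var e = Poly_Mapping.single (Poly_Mapping.single e 1) 1"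

definition incident_edges :: "'a set set \<Rightarrow> 'a \<Rightarrow> 'a set set" where
  "incident_edges E v = {e \<in> E. v \<in> e}"

definition Psi :: "'a set \<Rightarrow> 'a set set \<Rightarrow> ('a, 'r::comm_ring_1) edge_poly" where
  "Psi V E = (\<Prod>v\<in>V. 1 + vertex_var * (\<Prod>e\<in>incident_edges E v. edge_var e)) *
             (\<Prod>e\<in>E. 1 + edge_var e)"

definition edge_exponent :: "'a set set \<Rightarrow> ('a set \<Rightarrow>\<^sub>0 nat)" where
  "edge_exponent F = (\<Sum>e\<in>F. Poly_Mapping.single e 1)"

lemma prod_edge_var:
  "(\<Prod>e\<in>F. edge_var e :: ('a, 'r::comm_ring_1) edge_poly) = Poly_Mapping.single (edge_exponent F) 1"
  by (induction F rule: infinite_finite_induct)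
    (simp_all add: edge_exponent_def edge_var_def mult_single)

definition edge_coeff :: "'a set set \<Rightarrow> ('a, 'r::comm_ring_1) edge_poly \<Rightarrow> 'r poly" where
  "edge_coeff F P = Poly_Mapping.lookup P (edge_exponent F)"

end

theory Submission
  imports Defs
begin

text \<open>
  Write \<open>F\<close> for the complement edges. Expanding both products of \<open>\<Psi>\<close> gives one monomial for each
  pair of a vertex set \<open>K \<subseteq> V\<close> (the factors where \<open>z Z\<^sub>F(v)\<close> is chosen) and an edge set \<open>S \<subseteq> F\<close>
  (the factors where \<open>z\<^sub>e\<close> is chosen). Its coefficient is \<open>z\<close> to the power \<open>card K\<close>, and each
  \<open>e \<in> F\<close> occurs in it with exponent \<open>card (K \<inter> e)\<close>, increased by one if \<open>e \<in> S\<close>.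

  All these exponents equal one exactly when no \<open>e \<in> F\<close> lies inside \<open>K\<close> and \<open>S\<close> consists of the
  edges that avoid \<open>K\<close> (\<open>exponent_eq_iff\<close>). The first condition says that \<open>K\<close> is a clique of the
  original graph (\<open>clique_iff_complement_edges\<close>), and the second determines \<open>S\<close>. Hence every clique
  contributes its power of \<open>z\<close> exactly once to the extracted coefficient, and no other set
  contributes.
\<close>

lemma lookup_edge_exponent:
  assumes "finite F"
  shows "Poly_Mapping.lookup (edge_exponent F) e = of_bool (e \<in> F)"
  using assms by (simp add: edge_exponent_def lookup_sum lookup_single when_def)

lemma lookup_sum_incident_exponents:
  assumes "finite F" "finite K"
  shows "Poly_Mapping.lookup (\<Sum>v\<in>K. edge_exponent (incident_edges F v)) e
    = (if e \<in> F then card (K \<inter> e) else 0)"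
proof -
  have "finite (incident_edges F v)" for v
    using assms by (simp add: incident_edges_def)
  then have "Poly_Mapping.lookup (\<Sum>v\<in>K. edge_exponent (incident_edges F v)) e
      = (\<Sum>v\<in>K. of_bool (e \<in> F \<and> v \<in> e))"
    by (simp add: lookup_sum lookup_edge_exponent incident_edges_def)
  also have "\<dots> = (if e \<in> F then card (K \<inter> e) else 0)"
    using \<open>finite K\<close> by (simp add: of_bool_def sum.If_cases Int_def)
  finally show ?thesis .
qed

text \<open>
  Comparing exponents at \<open>e \<in> F\<close> gives \<open>card (K \<inter> e) + [e \<in> S] = 1\<close>: either \<open>e\<close> meets \<open>K\<close> once
  and is not in \<open>S\<close>, or it avoids \<open>K\<close> and is in \<open>S\<close>.
\<close>

lemma exponent_eq_iff:
  assumes "finite F" "finite K" "S \<subseteq> F"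
  shows "(\<Sum>v\<in>K. edge_exponent (incident_edges F v)) + edge_exponent S = edge_exponent F
    \<longleftrightarrow> S = {e \<in> F. K \<inter> e = {}} \<and> (\<forall>e\<in>F. card (K \<inter> e) \<le> 1)"
proof -
  have "finite S"
    using assms finite_subset by blast
  then have "(\<Sum>v\<in>K. edge_exponent (incident_edges F v)) + edge_exponent S = edge_exponent F
      \<longleftrightarrow> (\<forall>e\<in>F. card (K \<inter> e) + of_bool (e \<in> S) = 1)"
    using assms
    by (auto simp: poly_mapping_eq_iff fun_eq_iff lookup_add lookup_edge_exponent
        lookup_sum_incident_exponents)
  also have "\<dots> \<longleftrightarrow> (\<forall>e\<in>F. (e \<in> S \<longleftrightarrow> K \<inter> e = {}) \<and> card (K \<inter> e) \<le> 1)"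
  proof (intro ball_cong refl)
    fix e
    have "card (K \<inter> e) = 0 \<longleftrightarrow> K \<inter> e = {}"
      using \<open>finite K\<close> by simp
    then show "card (K \<inter> e) + of_bool (e \<in> S) = 1
        \<longleftrightarrow> (e \<in> S \<longleftrightarrow> K \<inter> e = {}) \<and> card (K \<inter> e) \<le> 1"
      by (cases "e \<in> S") auto
  qed
  also have "\<dots> \<longleftrightarrow> S = {e \<in> F. K \<inter> e = {}} \<and> (\<forall>e\<in>F. card (K \<inter> e) \<le> 1)"
    using \<open>S \<subseteq> F\<close> by blast
  finally show ?thesis .
qed

text \<open>
  A two-element set meets \<open>K\<close> more than once only if it is a pair of vertices of \<open>K\<close>; such a pair
  is a complement edge precisely when it is non-adjacent.
\<close>

lemma clique_iff_complement_edges: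
  assumes "K \<subseteq> V"
  shows "clique K E \<longleftrightarrow> (\<forall>e\<in>complement_edges V E. card (K \<inter> e) \<le> 1)"
proof
  assume K: "clique K E"
  show "\<forall>e\<in>complement_edges V E. card (K \<inter> e) \<le> 1"
  proof
    fix e assume "e \<in> complement_edges V E"
    then have "e \<in> [V]\<^bsup>2\<^esup>" "e \<notin> E"
      by (auto simp: complement_edges_def)
    then obtain x y where e: "e = {x, y}" "x \<noteq> y"
      by (auto elim: nsets2_E)
    have "\<not> (x \<in> K \<and> y \<in> K)"
      using K e \<open>e \<notin> E\<close> by (auto simp: clique_def)
    then have "K \<inter> e \<subseteq> {x} \<or> K \<inter> e \<subseteq> {y}"
      using e by blast
    then show "card (K \<inter> e) \<le> 1"
      by (auto dest: card_mono[rotated])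
  qed
next
  assume small: "\<forall>e\<in>complement_edges V E. card (K \<inter> e) \<le> 1"
  show "clique K E"
    unfolding clique_def
  proof (intro ballI impI)
    fix v w assume vw: "v \<in> K" "w \<in> K" "v \<noteq> w"
    then have "{v, w} \<in> [V]\<^bsup>2\<^esup>" "card (K \<inter> {v, w}) = 2"
      using assms by (auto simp: nsets_def)
    then show "{v, w} \<in> E"
      using small by (force simp: complement_edges_def)
  qed
qed

lemma prod_vertex_terms:
  "(\<Prod>v\<in>K. vertex_var * (\<Prod>e\<in>incident_edges F v. edge_var e) :: ('a, 'r::comm_ring_1) edge_poly)
    = Poly_Mapping.single (\<Sum>v\<in>K. edge_exponent (incident_edges F v)) (monom 1 (card K))"
  unfolding prod_edge_var
  by (induction K rule: infinite_finite_induct)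
    (simp_all add: vertex_var_def mult_single mult_monom add_ac)

lemma Psi_eq_sum_monomials:
  assumes "finite V" "finite F"
  shows "(Psi V F :: ('a, 'r::comm_ring_1) edge_poly) = (\<Sum>K\<in>Pow V. \<Sum>S\<in>Pow F.
    Poly_Mapping.single ((\<Sum>v\<in>K. edge_exponent (incident_edges F v)) + edge_exponent S)
      (monom 1 (card K)))"
proof -
  have expand: "(\<Prod>x\<in>A. 1 + f x) = (\<Sum>X\<in>Pow A. prod f X)"
    if "finite A" for A :: "'b set" and f :: "'b \<Rightarrow> ('a, 'r) edge_poly"
    using prod_add[OF that, of f "\<lambda>_. 1"] by (simp add: add.commute)
  show ?thesis
    unfolding Psi_def expand[OF assms(1)] expand[OF assms(2)] prod_vertex_terms
    by (simp add: prod_edge_var sum_product mult_single)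
qed

lemma clique_poly_eq_sum_cliques:
  assumes "finite V"
  shows "(clique_poly V E :: 'r::comm_ring_1 poly)
    = (\<Sum>K | K \<subseteq> V \<and> clique K E. monom 1 (card K))"
proof -
  let ?C = "{K. K \<subseteq> V \<and> clique K E}"
  have "(clique_poly V E :: 'r poly)
      = (\<Sum>k\<le>card V. \<Sum>K | K \<in> ?C \<and> card K = k. monom 1 (card K))"
    unfolding clique_poly_def clique_count_def
    by (intro sum.cong refl) (simp add: of_nat_monom mult_monom conj_assoc)
  also have "\<dots> = (\<Sum>K\<in>?C. monom 1 (card K))"
    using assms by (intro sum.group) (auto intro: card_mono)
  finally show ?thesis .
qed

theorem corollary4:
  fixes V :: "'a set" and E :: "'a set set"
  assumes "finite_simple_graph V E"
  shows "(clique_poly V E :: 'r::comm_ring_1 poly) =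
    edge_coeff (complement_edges V E) (Psi V (complement_edges V E))"
proof -
  let ?F = "complement_edges V E"
  have V: "finite V"
    using assms by (simp add: finite_simple_graph_def)
  then have F: "finite ?F"
    by (simp add: complement_edges_def finite_imp_finite_nsets)
  \<comment> \<open>The only edge set that can complete the monomial of \<open>K\<close> is the set of edges avoiding \<open>K\<close>.\<close>
  have one_K: "(\<Sum>S\<in>Pow ?F. monom 1 (card K) when
      (\<Sum>v\<in>K. edge_exponent (incident_edges ?F v)) + edge_exponent S = edge_exponent ?F)
    = ((if clique K E then monom 1 (card K) else 0) :: 'r poly)" if "K \<in> Pow V" for K
  proof -
    have "finite K" "K \<subseteq> V"
      using that V finite_subset by auto
    then have "(\<Sum>S\<in>Pow ?F. monom 1 (card K) when
        (\<Sum>v\<in>K. edge_exponent (incident_edges ?F v)) + edge_exponent S = edge_exponent ?F)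
      = (\<Sum>S\<in>Pow ?F. if S = {e \<in> ?F. K \<inter> e = {}}
          then if clique K E then monom 1 (card K) else 0 else (0 :: 'r poly))"
      using F by (intro sum.cong refl)
        (simp add: exponent_eq_iff clique_iff_complement_edges when_def)
    also have "\<dots> = (if clique K E then monom 1 (card K) else 0)"
      using F by (subst sum.delta) auto
    finally show ?thesis .
  qed
  have "edge_coeff ?F (Psi V ?F)
      = (\<Sum>K\<in>Pow V. (if clique K E then monom 1 (card K) else 0) :: 'r poly)"
    using one_K by (simp add: edge_coeff_def Psi_eq_sum_monomials[OF V F] lookup_sum lookup_single)
  also have "\<dots> = (\<Sum>K | K \<subseteq> V \<and> clique K E. monom 1 (card K))"
    using V by (simp add: sum.inter_filter[symmetric] Pow_def)
  also have "\<dots> = clique_poly V E"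
    using V by (simp add: clique_poly_eq_sum_cliques)
  finally show ?thesis by simp
qed

end
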